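(* Let $\mathcal{H}$ be a Hilbert space, let $T_1,\dots,T_m:\mathcal{H}\to\mathcal{H}$ be strictly quasi-nonexpansive operators, let $U_1,\dots,U_E$ be the string operators and $T=\sum_{t=1}^{E}\omega_t U_t$ the string averaging operator built from them (with $\omega_t>0$, $\sum_{t=1}^E\omega_t=1$), where $\mathrm{Fix}\,T\neq\emptyset$. Let the step size function be $\sigma=\sigma_{max}$, where $$\sigma_{max}(x)=\begin{cases}\dfrac{\sum_{t=1}^{E}\omega_t\|U_t(x)-x\|^2}{\|T(x)-x\|^2}, & x\in\mathcal{H}\setminus \mathrm{Fix}\,T,\\[2mm] 1, & x\in \mathrm{Fix}\,T.\end{cases}$$ Let $\varepsilon\in(0,\tfrac12)$ be an arbitrary constant and let $\lambda_k\in[\varepsilon,1-\varepsilon]$ for all $k\ge 0$. For an arbitrary $x^0\in\mathcal{H}$ define $$x^{k+1}=T_{\sigma,\lambda_k}(x^k)=x^k+\lambda_k\,\sigma(x^k)\,(T(x^k)-x^k),\qquad k\ge 0.$$ Then the sequence $\{x^k\}$ converges weakly to a point in $\mathrm{Fix}\,T$ if one of the following conditions is satisfied: (i) $T-Id$ is demi-closed at $0$; or (ii) $U_t-Id$ is demi-closed at $0$ for all $t=1,2,\dots,E$.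
   Context: $Id$ is the identity operator on $\mathcal{H}$ and $\mathrm{Fix}\,S=\{x\in\mathcal{H}: S(x)=x\}$. An operator $S:\mathcal{H}\to\mathcal{H}$ with $\mathrm{Fix}\,S\neq\emptyset$ is strictly quasi-nonexpansive (sQNE) if $\|S(x)-z\|<\|x-z\|$ for all $x\in\mathcal{H}\setminus \mathrm{Fix}\,S$ and all $z\in \mathrm{Fix}\,S$ (no continuity is assumed). String averaging: let $I=\{1,2,\dots,m\}$. For $t=1,\dots,E$ the string $I^t=(i_1^t,i_2^t,\dots,i_{m_t}^t)$ is an ordered subset of $I$, and $\bigcup_{t=1}^E I^t=I$. Put $U_t=T_{i^t_{m_t}}\cdots T_{i^t_2}T_{i^t_1}$ (composition) and $T=\sum_{t=1}^E\omega_t U_t$, where $\omega_t>0$ and $\sum_{t=1}^E\omega_t=1$. Generalized relaxation: for a step size function $\sigma:\mathcal{H}\to(0,\infty)$ and a relaxation parameter $\lambda\in[0,2]$, $T_{\sigma,\lambda}(x)=x+\lambda\sigma(x)(T(x)-x)$. An operator $S:\mathcal{H}\to\mathcal{H}$ is demi-closed at $0$ if for any sequence $x^k$ converging weakly to some $y\in\mathcal{H}$ with $S(x^k)\to 0$ we have $S(y)=0$.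
   Formalization: The formal theorem additionally assumes that T_1,…,T_m have a common fixed point; with only Fix T ≠ ∅ the claim fails (T_1=0, T_2=1 on the real line, strings (1),(2), weights 1/2, λ_k=2/5, x^0=3/4: the iterates alternate 3/4, 1/4). *)

theory Defs
  imports "HOL-Analysis.Analysis"
begin

definition Fix :: "('a \<Rightarrow> 'a) \<Rightarrow> 'a set" where
  "Fix S = {x. S x = x}"

definition sQNE :: "('a::real_normed_vector \<Rightarrow> 'a) \<Rightarrow> bool" where
  "sQNE S \<longleftrightarrow> Fix S \<noteq> {} \<and> (\<forall>x. x \<notin> Fix S \<longrightarrow> (\<forall>z\<in>Fix S. norm (S x - z) < norm (x - z)))"

text \<open>
  By the Riesz representation theorem, the bounded linear functionals on a Hilbert space are
  exactly the maps \<open>\<lambda>u. u \<bullet> h\<close>.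
\<close>

definition weakly_converges :: "(nat \<Rightarrow> 'a::real_inner) \<Rightarrow> 'a \<Rightarrow> bool" where
  "weakly_converges x y \<longleftrightarrow> (\<forall>h. (\<lambda>k. x k \<bullet> h) \<longlonglongrightarrow> y \<bullet> h)"

definition demi_closed_at_0 :: "('a::real_inner \<Rightarrow> 'a) \<Rightarrow> bool" where
  "demi_closed_at_0 S \<longleftrightarrow>
     (\<forall>x y. weakly_converges x y \<and> (\<lambda>k. S (x k)) \<longlonglongrightarrow> 0 \<longrightarrow> S y = 0)"

text \<open>An ordered subset of \<open>{1..m}\<close> is a list of pairwise distinct indices.\<close>

definition is_string :: "nat \<Rightarrow> nat list \<Rightarrow> bool" where
  "is_string m s \<longleftrightarrow> distinct s \<and> set s \<subseteq> {1..m}"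

text \<open>
  The first index of the string acts first:
  \<open>string_op T [i\<^sub>1, \<dots>, i\<^sub>r] = T i\<^sub>r \<circ> \<dots> \<circ> T i\<^sub>1\<close>;
  the empty string gives the identity.
\<close>

definition string_op :: "(nat \<Rightarrow> 'a \<Rightarrow> 'a) \<Rightarrow> nat list \<Rightarrow> 'a \<Rightarrow> 'a" where
  "string_op T s = fold T s"

definition string_average ::
    "nat \<Rightarrow> (nat \<Rightarrow> real) \<Rightarrow> (nat \<Rightarrow> 'a \<Rightarrow> 'a) \<Rightarrow> 'a::real_vector \<Rightarrow> 'a" where
  "string_average E \<omega> U x = (\<Sum>t=1..E. \<omega> t *\<^sub>R U t x)"

definition sigma_max ::
    "nat \<Rightarrow> (nat \<Rightarrow> real) \<Rightarrow> (nat \<Rightarrow> 'a \<Rightarrow> 'a) \<Rightarrow> 'a::real_normed_vector \<Rightarrow> real" where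
  "sigma_max E \<omega> U x =
     (if x \<in> Fix (string_average E \<omega> U) then 1
      else (\<Sum>t=1..E. \<omega> t * (norm (U t x - x))\<^sup>2) / (norm (string_average E \<omega> U x - x))\<^sup>2)"

definition gen_relaxation ::
    "('a \<Rightarrow> 'a) \<Rightarrow> ('a \<Rightarrow> real) \<Rightarrow> real \<Rightarrow> 'a::real_vector \<Rightarrow> 'a" where
  "gen_relaxation T \<sigma> lam x = x + (lam * \<sigma> x) *\<^sub>R (T x - x)"

end

theory Submission
  imports Defs "HOL-Library.Diagonal_Subsequence"
begin

text \<open>
  The iteration moves every iterate closer to every point of \<open>Fix T\<close>. A composition of strictly
  quasi-nonexpansive maps moves no point away from a common fixed point \<open>z\<close>
  (\<open>string_op_quasi_nonexpansive\<close>), and \<open>norm (U t x - z) \<le> norm (x - z)\<close> says, after squaring,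
  that \<open>(norm (U t x - x))\<^sup>2 \<le> 2 * ((U t x - x) \<bullet> (z - x))\<close>. Averaging over the strings gives
  \<open>(\<Sum>t. \<omega> t * (norm (U t x - x))\<^sup>2) \<le> 2 * ((T x - x) \<bullet> (z - x))\<close>. This inequality is used twice.

  At a fixed point \<open>x\<close> of \<open>T\<close> its right-hand side vanishes, so every string operator fixes \<open>x\<close>, and
  strictness then makes \<open>x\<close> a common fixed point of all the \<open>Ts i\<close>. Hence \<open>Fix T\<close> is exactly the set
  of common fixed points (\<open>Fix_string_average\<close>), and the inequality holds for every \<open>z \<in> Fix T\<close>.

  By the choice of \<open>\<sigma>\<close>, its left-hand side is \<open>\<sigma> x * (norm (T x - x))\<^sup>2\<close>. Expanding the square of
  the distance to \<open>z\<close>, one step with parameter \<open>lam\<close> decreases it by at least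
  \<open>lam * (1 - lam) * (\<sigma> x * norm (T x - x))\<^sup>2\<close> (\<open>extrapolated_step_decrease\<close>). With
  \<open>lam\<close> between \<open>\<epsilon>\<close> and \<open>1 - \<epsilon>\<close> it follows that the distances to \<open>z\<close> converge and that
  \<open>\<sigma> x * norm (T x - x)\<close> tends to \<open>0\<close> along the iteration. Since \<open>\<sigma> \<ge> 1\<close> by convexity of the square,
  \<open>T x - x\<close> tends to \<open>0\<close>, and so does \<open>\<sigma> x * (norm (T x - x))\<^sup>2\<close>, the weighted sum of all the
  \<open>(norm (U t x - x))\<^sup>2\<close>. Either form of demi-closedness therefore puts every weak cluster point of
  the iterates in \<open>Fix T\<close>.

  Opial's argument (\<open>opial\<close>) turns this into weak convergence. It rests on the existence of weak
  cluster points, that is, on the weak sequential compactness of bounded sets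
  (\<open>bounded_imp_weakly_convergent_subsequence\<close>), which is derived from nearest points in closed
  convex sets and the Riesz representation theorem.
\<close>

section \<open>Nearest points and the Riesz representation\<close>

text \<open>
  Completeness replaces compactness here: if \<open>u\<close> and \<open>v\<close> are the differences from \<open>h\<close> to two almost
  nearest points, then their midpoint also lies in \<open>C\<close>, so \<open>norm (u + v)\<close> is at least twice the
  distance, and the parallelogram law forces \<open>u - v\<close> to be short. A minimising sequence is thus Cauchy.
\<close>

lemma ex_nearest_point:
  fixes C :: "'a::{real_inner, complete_space} set"
  assumes "closed C" "convex C" "C \<noteq> {}"
  shows "\<exists>p\<in>C. \<forall>c\<in>C. norm (h - p) \<le> norm (h - c)"
proof -
  define d where "d = (INF c\<in>C. norm (h - c))"
  have bdd: "bdd_below ((\<lambda>c. norm (h - c)) ` C)"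
    by (rule bdd_belowI[of _ 0]) auto
  have d_le: "d \<le> norm (h - c)" if "c \<in> C" for c
    unfolding d_def using bdd that by (rule cINF_lower)
  have d_nonneg: "0 \<le> d"
    unfolding d_def using assms(3) by (intro cINF_greatest) auto
  have "\<exists>c\<in>C. norm (h - c) < d + inverse (real (Suc n))" for n
  proof -
    have "(INF c\<in>C. norm (h - c)) < d + inverse (real (Suc n))"
      by (simp add: d_def)
    then show ?thesis
      using cINF_less_iff[OF assms(3) bdd] by blast
  qed
  then obtain c where c: "\<And>n. c n \<in> C"
      and c_less: "\<And>n. norm (h - c n) < d + inverse (real (Suc n))"
    by metis
  define g where "g n = 2 * ((norm (h - c n))\<^sup>2 - d\<^sup>2)" for n
  have lim: "(\<lambda>n. norm (h - c n)) \<longlonglongrightarrow> d"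
  proof (rule tendsto_sandwich[OF _ _ tendsto_const])
    show "(\<lambda>n. d + inverse (real (Suc n))) \<longlonglongrightarrow> d"
      by (rule LIMSEQ_inverse_real_of_nat_add)
    show "\<forall>\<^sub>F n in sequentially. d \<le> norm (h - c n)"
      using c d_le by simp
    show "\<forall>\<^sub>F n in sequentially. norm (h - c n) \<le> d + inverse (real (Suc n))"
      using c_less less_imp_le by (intro always_eventually allI) blast
  qed
  have "g \<longlonglongrightarrow> 2 * (d\<^sup>2 - d\<^sup>2)"
    unfolding g_def by (intro tendsto_intros lim)
  then have g_lim: "g \<longlonglongrightarrow> 0" by simp
  have dist_le: "(dist (c i) (c j))\<^sup>2 \<le> g i + g j" for i j
  proof -
    define u where "u = h - c i"
    define v where "v = h - c j"
    define mid where "mid = (1/2) *\<^sub>R c i + (1/2) *\<^sub>R c j"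
    have "mid \<in> C"
      unfolding mid_def using assms(2) c by (intro convexD) auto
    then have "d\<^sup>2 \<le> (norm (h - mid))\<^sup>2"
      using d_le d_nonneg by (simp add: power_mono)
    moreover have "h - mid = (1/2) *\<^sub>R (u + v)"
    proof -
      have "(1/2) *\<^sub>R (u + v) = ((1/2) *\<^sub>R h + (1/2) *\<^sub>R h) - mid"
        by (simp add: u_def v_def mid_def algebra_simps)
      then show ?thesis by (simp flip: scaleR_add_left)
    qed
    ultimately have "4 * d\<^sup>2 \<le> (norm (u + v))\<^sup>2"
      by (simp add: power_divide)
    moreover have "(norm (u - v))\<^sup>2 + (norm (u + v))\<^sup>2 = 2 * (norm u)\<^sup>2 + 2 * (norm v)\<^sup>2"
      by (simp add: power2_norm_eq_inner algebra_simps inner_commute)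
    moreover have "dist (c i) (c j) = norm (u - v)"
      by (simp add: u_def v_def dist_norm norm_minus_commute)
    ultimately show ?thesis
      by (simp add: g_def u_def v_def)
  qed
  have "Cauchy c"
  proof (rule metric_CauchyI)
    fix e :: real assume "0 < e"
    then have "\<forall>\<^sub>F n in sequentially. g n < e\<^sup>2 / 2"
      using g_lim by (intro order_tendstoD(2)) auto
    then obtain N where N: "\<And>n. n \<ge> N \<Longrightarrow> g n < e\<^sup>2 / 2"
      by (auto simp: eventually_sequentially)
    have "dist (c i) (c j) < e" if "i \<ge> N" "j \<ge> N" for i j
    proof -
      have "(dist (c i) (c j))\<^sup>2 < e\<^sup>2"
        using dist_le[of i j] N[OF that(1)] N[OF that(2)] by linarith
      then show ?thesis
        using \<open>0 < e\<close> by (simp add: power_less_imp_less_base)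
    qed
    then show "\<exists>N. \<forall>i\<ge>N. \<forall>j\<ge>N. dist (c i) (c j) < e" by blast
  qed
  then obtain p where p: "c \<longlonglongrightarrow> p"
    using Cauchy_convergent convergent_def by blast
  have "p \<in> C"
    using assms(1) c p closed_sequentially by blast
  moreover have "(\<lambda>n. norm (h - c n)) \<longlonglongrightarrow> norm (h - p)"
    using p by (intro tendsto_intros)
  then have "norm (h - p) = d"
    using lim LIMSEQ_unique by blast
  ultimately show ?thesis
    using d_le by blast
qed

text \<open>
  The residual \<open>h - p\<close> of a nearest point is orthogonal to every line through \<open>p\<close> that stays in \<open>C\<close>,
  since otherwise sliding along that line would come closer to \<open>h\<close>. Stated this way it covers
  subspaces and the affine hyperplanes needed for the Riesz representation alike.
\<close>

lemma ex_nearest_point_orthogonal: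
  fixes C :: "'a::{real_inner, complete_space} set"
  assumes "closed C" "convex C" "C \<noteq> {}"
  shows "\<exists>p\<in>C. \<forall>v. (\<forall>t. p + t *\<^sub>R v \<in> C) \<longrightarrow> (h - p) \<bullet> v = 0"
proof -
  obtain p where p: "p \<in> C" "\<And>c. c \<in> C \<Longrightarrow> norm (h - p) \<le> norm (h - c)"
    using ex_nearest_point[OF assms] by blast
  have "(h - p) \<bullet> v = 0" if line: "\<forall>t. p + t *\<^sub>R v \<in> C" for v
  proof (cases "v = 0")
    case False
    define q where "q = h - p"
    \<comment> \<open>the parameter of the point of the line nearest to \<open>h\<close>\<close>
    define t where "t = (q \<bullet> v) / (v \<bullet> v)"
    have pos: "0 < v \<bullet> v" using False by simp
    have "norm q \<le> norm (q - t *\<^sub>R v)"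
      using p(2)[OF line[rule_format, of t]] by (simp add: q_def algebra_simps)
    then have "q \<bullet> q \<le> (q - t *\<^sub>R v) \<bullet> (q - t *\<^sub>R v)"
      by (simp add: norm_le)
    also have "\<dots> = q \<bullet> q - 2 * t * (q \<bullet> v) + t * (t * (v \<bullet> v))"
      by (simp add: inner_diff inner_commute algebra_simps)
    also have "\<dots> = q \<bullet> q - (q \<bullet> v)\<^sup>2 / (v \<bullet> v)"
      using pos by (simp add: t_def power2_eq_square)
    finally have "(q \<bullet> v)\<^sup>2 \<le> 0"
      using pos by (simp add: divide_le_0_iff)
    then show ?thesis by (simp add: q_def)
  qed simp
  with p(1) show ?thesis by blast
qed

text \<open>
  The representing vector is a multiple of the point \<open>p\<close> of least norm on the hyperplane \<open>f h = 1\<close>: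
  all the lines in that hyperplane through \<open>p\<close> have directions in the kernel of \<open>f\<close>, so \<open>p\<close> is
  orthogonal to the kernel, and \<open>h - f h *\<^sub>R p\<close> lies in the kernel.
\<close>

lemma riesz_representation:
  fixes f :: "'a::{real_inner, complete_space} \<Rightarrow> real"
  assumes "bounded_linear f"
  shows "\<exists>y. \<forall>h. f h = y \<bullet> h"
proof (cases "\<forall>h. f h = 0")
  case True
  then show ?thesis by (intro exI[of _ 0]) simp
next
  case False
  then obtain h0 where h0: "f h0 \<noteq> 0" by blast
  interpret f: bounded_linear f by fact
  define C where "C = {h. f h = 1}"
  have "closed C"
    unfolding C_def
    by (intro closed_Collect_eq continuous_intros f.continuous_on)
  moreover have "convex C"
    by (auto simp: C_def convex_def f.add f.scale)
  moreover have "h0 /\<^sub>R f h0 \<in> C"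
    using h0 by (simp add: C_def f.scale)
  ultimately obtain p where p: "p \<in> C"
      and orth: "\<And>v. \<forall>t. p + t *\<^sub>R v \<in> C \<Longrightarrow> (0 - p) \<bullet> v = 0"
    using ex_nearest_point_orthogonal[of C 0] by blast
  have fp: "f p = 1" using p by (simp add: C_def)
  then have "p \<noteq> 0" using f.zero by auto
  have "f h = (p /\<^sub>R (p \<bullet> p)) \<bullet> h" for h
  proof -
    have "(0 - p) \<bullet> (h - f h *\<^sub>R p) = 0"
      by (rule orth) (simp add: C_def f.add f.scale f.diff fp)
    then show ?thesis
      using \<open>p \<noteq> 0\<close> by (simp add: inner_diff_right field_simps)
  qed
  then show ?thesis by blast
qed

section \<open>Weak sequential compactness\<close>

lemma subspace_pairing_convergent:
  fixes y :: "nat \<Rightarrow> 'a::real_inner"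
  shows "subspace {h. convergent (\<lambda>j. y j \<bullet> h)}"
  unfolding subspace_def
  by (auto simp: inner_add_right convergent_const intro!: convergent_add convergent_mult)

text \<open>
  Boundedness makes the pairings equicontinuous in \<open>h\<close>, so the Cauchy property passes to limits of \<open>h\<close>.
\<close>

lemma closed_pairing_convergent:
  fixes y :: "nat \<Rightarrow> 'a::real_inner"
  assumes B: "\<And>j. norm (y j) \<le> B"
  shows "closed {h. convergent (\<lambda>j. y j \<bullet> h)}" (is "closed ?W")
proof -
  have "convergent (\<lambda>j. y j \<bullet> h)" if h: "h \<in> closure ?W" for h
  proof (rule Cauchy_convergent, rule metric_CauchyI)
    fix e :: real assume e: "0 < e"
    have B0: "0 \<le> B" using B[of 0] norm_ge_zero order_trans by blast
    \<comment> \<open>\<open>B + 1\<close> instead of \<open>B\<close> keeps the divisor positive when \<open>B = 0\<close>\<close>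
    then have "0 < e / (3 * (B + 1))" using e by simp
    then obtain w where w: "w \<in> ?W" "dist w h < e / (3 * (B + 1))"
      using h closure_approachable by blast
    have small: "\<bar>y j \<bullet> h - y j \<bullet> w\<bar> < e / 3" for j
    proof -
      have "\<bar>y j \<bullet> h - y j \<bullet> w\<bar> \<le> norm (y j) * norm (h - w)"
        using Cauchy_Schwarz_ineq2[of "y j" "h - w"] by (simp add: inner_diff_right)
      also have "\<dots> \<le> (B + 1) * norm (h - w)"
        using B[of j] by (intro mult_right_mono) auto
      also have "\<dots> < (B + 1) * (e / (3 * (B + 1)))"
        using w(2) B0 by (intro mult_strict_left_mono) (auto simp: dist_norm norm_minus_commute)
      also have "\<dots> = e / 3" using B0 by (simp add: field_simps)
      finally show ?thesis .
    qed
    have "Cauchy (\<lambda>j. y j \<bullet> w)"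
      using w(1) convergent_Cauchy by blast
    then obtain N where N: "\<And>i j. i \<ge> N \<Longrightarrow> j \<ge> N \<Longrightarrow> dist (y i \<bullet> w) (y j \<bullet> w) < e / 3"
      using e metric_CauchyD[of "\<lambda>j. y j \<bullet> w" "e / 3"] by auto
    have "dist (y i \<bullet> h) (y j \<bullet> h) < e" if "i \<ge> N" "j \<ge> N" for i j
      using small[of i] small[of j] N[OF that] unfolding dist_real_def by linarith
    then show "\<exists>N. \<forall>i\<ge>N. \<forall>j\<ge>N. dist (y i \<bullet> h) (y j \<bullet> h) < e" by blast
  qed
  then show ?thesis
    using closure_subset_eq[of ?W] by blast
qed

lemma weakly_convergent_if_pairings_converge:
  fixes y :: "nat \<Rightarrow> 'a::{real_inner, complete_space}"
  assumes B: "\<And>j. norm (y j) \<le> B" and conv: "\<And>h. convergent (\<lambda>j. y j \<bullet> h)"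
  shows "\<exists>l. weakly_converges y l"
proof -
  define f where "f h = lim (\<lambda>j. y j \<bullet> h)" for h
  have f: "(\<lambda>j. y j \<bullet> h) \<longlonglongrightarrow> f h" for h
    using conv by (simp add: f_def convergent_LIMSEQ_iff)
  have "bounded_linear f"
  proof (rule bounded_linear_intro)
    fix g h :: 'a and r :: real
    have "(\<lambda>j. y j \<bullet> (g + h)) \<longlonglongrightarrow> f g + f h"
      unfolding inner_add_right by (intro tendsto_add f)
    then show "f (g + h) = f g + f h"
      using f LIMSEQ_unique by blast
    have "(\<lambda>j. y j \<bullet> (r *\<^sub>R h)) \<longlonglongrightarrow> r *\<^sub>R f h"
      unfolding inner_scaleR_right real_scaleR_def by (intro tendsto_intros f)
    then show "f (r *\<^sub>R h) = r *\<^sub>R f h"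
      using f LIMSEQ_unique by blast
    have "norm (y j \<bullet> h) \<le> norm h * B" for j
    proof -
      have "norm (y j \<bullet> h) \<le> norm (y j) * norm h"
        by (simp add: Cauchy_Schwarz_ineq2)
      also have "\<dots> \<le> B * norm h" using B by (intro mult_right_mono) auto
      finally show ?thesis by (simp add: mult.commute)
    qed
    then show "norm (f h) \<le> norm h * B"
      using f[of h] by (intro Lim_norm_ubound[of sequentially]) auto
  qed
  then obtain l where "\<And>h. f h = l \<bullet> h"
    using riesz_representation by blast
  then show ?thesis
    using f by (auto simp: weakly_converges_def)
qed

text \<open>
  The space may be non-separable, so the diagonal argument runs only over the pairings with the terms
  of the sequence itself. The vectors whose pairings with the extracted subsequence converge form a
  closed subspace \<open>W\<close> containing those terms. Any \<open>h\<close> differs from its nearest point in \<open>W\<close> by a vector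
  orthogonal to \<open>W\<close>, whose pairings are all \<open>0\<close>; hence the pairings with \<open>h\<close> converge too.
\<close>

lemma bounded_imp_weakly_convergent_subsequence:
  fixes x :: "nat \<Rightarrow> 'a::{real_inner, complete_space}"
  assumes B: "\<And>k. norm (x k) \<le> B"
  shows "\<exists>r l. strict_mono r \<and> weakly_converges (x \<circ> r) l"
proof -
  define P where "P n r \<longleftrightarrow> convergent (\<lambda>j. x (r j) \<bullet> x n)" for n and r :: "nat \<Rightarrow> nat"
  interpret subseqs P
  proof
    fix n and s :: "nat \<Rightarrow> nat"
    have "\<bar>x (s j) \<bullet> x n\<bar> \<le> B * B" for j
    proof -
      have "\<bar>x (s j) \<bullet> x n\<bar> \<le> norm (x (s j)) * norm (x n)"
        by (rule Cauchy_Schwarz_ineq2)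
      also have "\<dots> \<le> B * B"
        using B by (intro mult_mono') auto
      finally show ?thesis .
    qed
    then have "bounded (range (\<lambda>j. x (s j) \<bullet> x n))"
      unfolding bounded_iff by auto
    then obtain l and r :: "nat \<Rightarrow> nat"
      where "strict_mono r" "((\<lambda>j. x (s j) \<bullet> x n) \<circ> r) \<longlonglongrightarrow> l"
      using bounded_imp_convergent_subsequence by blast
    then show "\<exists>r'. strict_mono r' \<and> P n (s \<circ> r')"
      by (auto simp: P_def convergent_def o_def)
  qed
  define y where "y = x \<circ> diagseq"
  have on_terms: "convergent (\<lambda>j. y j \<bullet> x n)" for n
  proof -
    have "P n (diagseq \<circ> (+) (Suc n))"
    proof (rule diagseq_holds)
      fix r s :: "nat \<Rightarrow> nat" and n
      assume "strict_mono r" "P n s"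
      then show "P n (s \<circ> r)"
        using convergent_subseq_convergent[of "\<lambda>j. x (s j) \<bullet> x n" r]
        by (simp add: P_def o_def)
    qed
    then show ?thesis
      using convergent_ignore_initial_segment[of "\<lambda>j. y j \<bullet> x n" "Suc n"]
      by (simp add: P_def y_def add.commute)
  qed
  have yB: "norm (y j) \<le> B" for j using B by (simp add: y_def)
  define W where "W = {h. convergent (\<lambda>j. y j \<bullet> h)}"
  have sub: "subspace W"
    unfolding W_def by (rule subspace_pairing_convergent)
  have "convergent (\<lambda>j. y j \<bullet> h)" for h
  proof -
    have "closed W"
      unfolding W_def using yB by (rule closed_pairing_convergent)
    moreover have "W \<noteq> {}" using subspace_0[OF sub] by blast
    ultimately obtain p where p: "p \<in> W"
        and orth: "\<And>v. \<forall>t. p + t *\<^sub>R v \<in> W \<Longrightarrow> (h - p) \<bullet> v = 0"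
      using ex_nearest_point_orthogonal[of W h] subspace_imp_convex[OF sub] by blast
    have "y j \<in> W" for j
      using on_terms by (simp add: W_def y_def)
    then have orth_y: "(h - p) \<bullet> y j = 0" for j
      using p sub by (intro orth) (simp add: subspace_add subspace_scale)
    have "y j \<bullet> h = y j \<bullet> p" for j
      using orth_y[of j] by (simp add: inner_diff_left inner_commute[of "y j"])
    with p show ?thesis by (simp add: W_def)
  qed
  with yB obtain l where "weakly_converges y l"
    using weakly_convergent_if_pairings_converge by blast
  then show ?thesis
    using subseq_diagseq by (auto simp: y_def)
qed

section \<open>Weak convergence from cluster points\<close>

text \<open>
  For two weak cluster points \<open>z\<close> and \<open>z'\<close>, both in \<open>F\<close>, the difference of the squared distances of
  \<open>x k\<close> to \<open>z'\<close> and \<open>z\<close> converges; up to a constant this difference is \<open>2 * (x k \<bullet> (z - z'))\<close>. So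
  \<open>z\<close> and \<open>z'\<close> have the same pairing with \<open>z - z'\<close>, which makes them equal. A bounded sequence
  with only one weak cluster point converges weakly to it.
\<close>

lemma opial:
  fixes x :: "nat \<Rightarrow> 'a::{real_inner, complete_space}"
  assumes "F \<noteq> {}"
    and conv: "\<And>z. z \<in> F \<Longrightarrow> convergent (\<lambda>k. norm (x k - z))"
    and cluster: "\<And>r l. strict_mono r \<Longrightarrow> weakly_converges (x \<circ> r) l \<Longrightarrow> l \<in> F"
  shows "\<exists>z\<in>F. weakly_converges x z"
proof -
  obtain z0 where "z0 \<in> F" using assms(1) by blast
  then have "Bseq (\<lambda>k. norm (x k - z0))"
    using conv by (intro convergent_imp_Bseq)
  then obtain K where K: "\<And>k. norm (x k - z0) \<le> K"
    by (auto simp: Bseq_def)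
  have B: "norm (x k) \<le> K + norm z0" for k
    using norm_triangle_ineq[of "x k - z0" z0] K[of k] by simp
  have unique: "z = z'"
    if r: "strict_mono r" "weakly_converges (x \<circ> r) z"
      and s: "strict_mono s" "weakly_converges (x \<circ> s) z'" for r s z z'
  proof -
    have "z \<in> F" "z' \<in> F" using cluster r s by blast+
    then have "convergent (\<lambda>k. ((norm (x k - z'))\<^sup>2 - (norm (x k - z))\<^sup>2 + (norm z)\<^sup>2 - (norm z')\<^sup>2) * (1/2))"
      unfolding power2_eq_square
      by (intro convergent_mult convergent_diff convergent_add conv convergent_const)
    moreover have "((norm (x k - z'))\<^sup>2 - (norm (x k - z))\<^sup>2 + (norm z)\<^sup>2 - (norm z')\<^sup>2) * (1/2)
        = x k \<bullet> (z - z')" for k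
      by (simp add: power2_norm_eq_inner inner_diff inner_commute algebra_simps)
    ultimately obtain L where L: "(\<lambda>k. x k \<bullet> (z - z')) \<longlonglongrightarrow> L"
      by (auto simp: convergent_def)
    have "L = z \<bullet> (z - z')" "L = z' \<bullet> (z - z')"
      using LIMSEQ_subseq_LIMSEQ[OF L r(1)] LIMSEQ_subseq_LIMSEQ[OF L s(1)] r(2) s(2)
      unfolding weakly_converges_def o_def by (blast intro: LIMSEQ_unique)+
    then have "(z - z') \<bullet> (z - z') = 0" by (simp add: inner_diff_left)
    then show ?thesis by simp
  qed
  obtain r z where r: "strict_mono r" "weakly_converges (x \<circ> r) z"
    using bounded_imp_weakly_convergent_subsequence[of x, OF B] by blast
  have "(\<lambda>k. x k \<bullet> h) \<longlonglongrightarrow> z \<bullet> h" for h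
  proof (rule ccontr)
    assume "\<not> ?thesis"
    then obtain e where e: "0 < e" and "\<exists>\<^sub>F k in sequentially. \<not> dist (x k \<bullet> h) (z \<bullet> h) < e"
      by (auto simp: tendsto_iff not_eventually)
    then have "infinite {k. \<not> dist (x k \<bullet> h) (z \<bullet> h) < e}"
      using INFM_iff_infinite cofinite_eq_sequentially by metis
    then obtain s :: "nat \<Rightarrow> nat"
      where s: "strict_mono s" "\<And>k. \<not> dist (x (s k) \<bullet> h) (z \<bullet> h) < e"
      using infinite_enumerate by blast
    have "norm ((x \<circ> s) k) \<le> K + norm z0" for k using B by simp
    then obtain q z' where q: "strict_mono q" "weakly_converges ((x \<circ> s) \<circ> q) z'"
      using bounded_imp_weakly_convergent_subsequence by blast
    have "z' = z"
      using unique[of "s \<circ> q" z' r z] q r strict_mono_o[OF s(1) q(1)] by (simp add: o_assoc)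
    then have "(\<lambda>k. x (s (q k)) \<bullet> h) \<longlonglongrightarrow> z \<bullet> h"
      using q(2) by (simp add: weakly_converges_def)
    then have "\<forall>\<^sub>F k in sequentially. dist (x (s (q k)) \<bullet> h) (z \<bullet> h) < e"
      using e tendstoD by blast
    then show False
      using s(2) by (auto simp: eventually_sequentially)
  qed
  then show ?thesis
    using cluster[OF r] by (auto simp: weakly_converges_def)
qed

lemma demi_closed_zero_of_subsequence:
  assumes "demi_closed_at_0 S" "(\<lambda>k. S (x k)) \<longlonglongrightarrow> 0"
    and "strict_mono r" "weakly_converges (x \<circ> r) l"
  shows "S l = 0"
  using assms LIMSEQ_subseq_LIMSEQ[OF assms(2,3)]
  unfolding demi_closed_at_0_def o_def by blast

section \<open>Strings and their averages\<close>

text \<open>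
  The second part is where strictness enters: the first operator of the string that moves the point
  strictly decreases the distance to \<open>z\<close>, and the later operators cannot undo this.
\<close>

lemma string_op_quasi_nonexpansive:
  assumes "\<And>i. i \<in> set s \<Longrightarrow> sQNE (Ts i)" and "\<And>i. i \<in> set s \<Longrightarrow> z \<in> Fix (Ts i)"
  shows "norm (string_op Ts s x - z) \<le> norm (x - z)"
    and "norm (string_op Ts s x - z) = norm (x - z) \<Longrightarrow> i \<in> set s \<Longrightarrow> x \<in> Fix (Ts i)"
proof -
  have "norm (fold Ts s x - z) \<le> norm (x - z) \<and>
      (norm (fold Ts s x - z) = norm (x - z) \<longrightarrow> (\<forall>i\<in>set s. x \<in> Fix (Ts i)))"
    using assms
  proof (induction s arbitrary: x)
    case (Cons a s)
    have IH: "norm (fold Ts s y - z) \<le> norm (y - z) \<and>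
        (norm (fold Ts s y - z) = norm (y - z) \<longrightarrow> (\<forall>i\<in>set s. y \<in> Fix (Ts i)))" for y
      using Cons by simp
    show ?case
    proof (cases "x \<in> Fix (Ts a)")
      case True
      then have "Ts a x = x" by (simp add: Fix_def)
      then show ?thesis using IH[of x] True by simp
    next
      case False
      have "sQNE (Ts a)" "z \<in> Fix (Ts a)" using Cons.prems by auto
      then have "norm (Ts a x - z) < norm (x - z)"
        using False by (auto simp: sQNE_def)
      then show ?thesis using IH[of "Ts a x"] by simp
    qed
  qed simp
  then show "norm (string_op Ts s x - z) \<le> norm (x - z)"
    and "norm (string_op Ts s x - z) = norm (x - z) \<Longrightarrow> i \<in> set s \<Longrightarrow> x \<in> Fix (Ts i)"
    by (auto simp: string_op_def)
qed

lemma string_op_fixed: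
  assumes "\<And>i. i \<in> set s \<Longrightarrow> z \<in> Fix (Ts i)"
  shows "z \<in> Fix (string_op Ts s)"
  using assms unfolding string_op_def Fix_def by (induction s) auto

lemma string_average_residual:
  assumes "(\<Sum>t=1..E. \<omega> t) = 1"
  shows "string_average E \<omega> U x - x = (\<Sum>t=1..E. \<omega> t *\<^sub>R (U t x - x))"
  using assms by (simp add: string_average_def algebra_simps sum_subtractf flip: scaleR_sum_left)

text \<open>
  The vector \<open>T x - x\<close> points towards \<open>z\<close>, with a quantitative gain. Expanding
  \<open>norm (U t x - z)\<close> around \<open>x\<close> shows this for each string, and the conclusion is the average.
\<close>

lemma string_average_residual_inner:
  fixes x z :: "'a::real_inner"
  assumes "\<And>t. t \<in> {1..E} \<Longrightarrow> \<omega> t \<ge> 0" and "(\<Sum>t=1..E. \<omega> t) = 1"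
    and qne: "\<And>t. t \<in> {1..E} \<Longrightarrow> norm (U t x - z) \<le> norm (x - z)"
  shows "(\<Sum>t=1..E. \<omega> t * (norm (U t x - x))\<^sup>2) \<le> 2 * ((string_average E \<omega> U x - x) \<bullet> (z - x))"
proof -
  have "(norm (U t x - x))\<^sup>2 \<le> 2 * ((U t x - x) \<bullet> (z - x))" if "t \<in> {1..E}" for t
  proof -
    have "(norm (U t x - z))\<^sup>2 \<le> (norm (x - z))\<^sup>2"
      using qne[OF that] by (simp add: power_mono)
    then show ?thesis
      by (simp add: power2_norm_eq_inner inner_diff inner_commute algebra_simps)
  qed
  then have "(\<Sum>t=1..E. \<omega> t * (norm (U t x - x))\<^sup>2)
      \<le> (\<Sum>t=1..E. \<omega> t * (2 * ((U t x - x) \<bullet> (z - x))))"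
    using assms(1) by (intro sum_mono mult_left_mono) auto
  also have "\<dots> = 2 * ((string_average E \<omega> U x - x) \<bullet> (z - x))"
    unfolding string_average_residual[OF assms(2)]
    unfolding inner_sum_left sum_distrib_left inner_scaleR_left
    by (intro sum.cong refl) (rule mult.left_commute)
  finally show ?thesis .
qed

text \<open>
  Jensen's inequality for the squared norm: the difference of the two sides is the weighted
  variance of the vectors \<open>U t x - x\<close>.
\<close>

lemma norm_string_average_residual_le:
  fixes x :: "'a::real_inner"
  assumes "\<And>t. t \<in> {1..E} \<Longrightarrow> \<omega> t \<ge> 0" and "(\<Sum>t=1..E. \<omega> t) = 1"
  shows "(norm (string_average E \<omega> U x - x))\<^sup>2 \<le> (\<Sum>t=1..E. \<omega> t * (norm (U t x - x))\<^sup>2)"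
proof -
  define v where "v = string_average E \<omega> U x - x"
  have "0 \<le> (\<Sum>t=1..E. \<omega> t * (norm (U t x - x - v))\<^sup>2)"
    using assms(1) by (intro sum_nonneg mult_nonneg_nonneg) auto
  also have "\<dots> = (\<Sum>t=1..E. \<omega> t * (norm (U t x - x))\<^sup>2 - 2 * ((\<omega> t *\<^sub>R (U t x - x)) \<bullet> v)
      + \<omega> t * (v \<bullet> v))"
    by (intro sum.cong refl)
      (simp add: power2_norm_eq_inner inner_diff inner_commute algebra_simps)
  also have "\<dots> = (\<Sum>t=1..E. \<omega> t * (norm (U t x - x))\<^sup>2)
      - 2 * ((\<Sum>t=1..E. \<omega> t *\<^sub>R (U t x - x)) \<bullet> v) + (\<Sum>t=1..E. \<omega> t) * (v \<bullet> v)"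
    by (simp add: sum.distrib sum_subtractf inner_sum_left sum_distrib_left sum_distrib_right)
  also have "\<dots> = (\<Sum>t=1..E. \<omega> t * (norm (U t x - x))\<^sup>2) - v \<bullet> v"
    unfolding string_average_residual[OF assms(2), symmetric] assms(2) by (simp add: v_def)
  finally show ?thesis
    by (simp add: v_def power2_norm_eq_inner)
qed

text \<open>
  A fixed point of the average could a priori arise from string operators that move it in opposite
  directions. The common fixed point \<open>z\<close> excludes this: the residual inequality forces all the
  string residuals to vanish, and then strictness applies inside each string. Covering \<open>{1..m}\<close> by
  the strings makes this reach every operator.
\<close>

lemma Fix_string_average:
  fixes Ts :: "nat \<Rightarrow> 'a::real_inner \<Rightarrow> 'a"
  assumes "\<And>i. i \<in> {1..m} \<Longrightarrow> sQNE (Ts i)"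
    and "(\<Inter>i\<in>{1..m}. Fix (Ts i)) \<noteq> {}"
    and cover: "(\<Union>t\<in>{1..E}. set (I t)) = {1..m}"
    and pos: "\<And>t. t \<in> {1..E} \<Longrightarrow> \<omega> t > 0"
    and sum1: "(\<Sum>t=1..E. \<omega> t) = 1"
  shows "Fix (string_average E \<omega> (\<lambda>t. string_op Ts (I t))) = (\<Inter>i\<in>{1..m}. Fix (Ts i))"
proof
  let ?U = "\<lambda>t. string_op Ts (I t)"
  have in_range: "i \<in> {1..m}" if "t \<in> {1..E}" "i \<in> set (I t)" for i t
    using cover that by blast
  obtain z where z: "\<And>i. i \<in> {1..m} \<Longrightarrow> z \<in> Fix (Ts i)"
    using assms(2) by blast
  show "Fix (string_average E \<omega> ?U) \<subseteq> (\<Inter>i\<in>{1..m}. Fix (Ts i))"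
  proof
    fix x assume "x \<in> Fix (string_average E \<omega> ?U)"
    then have "string_average E \<omega> ?U x - x = 0" by (simp add: Fix_def)
    moreover have "norm (?U t x - z) \<le> norm (x - z)" if "t \<in> {1..E}" for t
      using in_range[OF that] assms(1) z by (intro string_op_quasi_nonexpansive(1)) auto
    ultimately have sum_le: "(\<Sum>t=1..E. \<omega> t * (norm (?U t x - x))\<^sup>2) \<le> 0"
      using string_average_residual_inner[of E \<omega> ?U x z, OF less_imp_le[OF pos] sum1] by simp
    have zero: "\<omega> t * (norm (?U t x - x))\<^sup>2 \<le> 0" if "t \<in> {1..E}" for t
    proof -
      have "\<omega> t * (norm (?U t x - x))\<^sup>2 \<le> (\<Sum>t=1..E. \<omega> t * (norm (?U t x - x))\<^sup>2)"
        using that less_imp_le[OF pos] by (intro member_le_sum) auto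
      with sum_le show ?thesis by linarith
    qed
    have "x \<in> Fix (Ts i)" if i: "i \<in> {1..m}" for i
    proof -
      obtain t where t: "t \<in> {1..E}" "i \<in> set (I t)"
        using cover i by blast
      have "?U t x = x"
        using zero[OF t(1)] pos[OF t(1)] by (simp add: mult_le_0_iff)
      then show ?thesis
        using in_range[OF t(1)] assms(1) z t(2)
          string_op_quasi_nonexpansive(2)[of "I t" Ts z x i]
        by simp
    qed
    then show "x \<in> (\<Inter>i\<in>{1..m}. Fix (Ts i))" by blast
  qed
  show "(\<Inter>i\<in>{1..m}. Fix (Ts i)) \<subseteq> Fix (string_average E \<omega> ?U)"
  proof
    fix x assume x: "x \<in> (\<Inter>i\<in>{1..m}. Fix (Ts i))"
    have "?U t x = x" if "t \<in> {1..E}" for t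
      using string_op_fixed[of "I t" x Ts] in_range[OF that] x by (auto simp: Fix_def)
    then have "string_average E \<omega> ?U x - x = 0"
      unfolding string_average_residual[OF sum1] by (intro sum.neutral) auto
    then show "x \<in> Fix (string_average E \<omega> ?U)" by (simp add: Fix_def)
  qed
qed

section \<open>The extrapolated iteration\<close>

text \<open>
  Off \<open>Fix T\<close> this is the defining quotient cleared of its denominator. At a fixed point of \<open>T\<close> both
  sides vanish, which is why the string operators must fix that point as well.
\<close>

lemma sigma_max_residual:
  fixes U :: "nat \<Rightarrow> 'a::real_normed_vector \<Rightarrow> 'a"
  assumes "\<And>t. t \<in> {1..E} \<Longrightarrow> Fix (string_average E \<omega> U) \<subseteq> Fix (U t)"
  shows "sigma_max E \<omega> U x * (norm (string_average E \<omega> U x - x))\<^sup>2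
    = (\<Sum>t=1..E. \<omega> t * (norm (U t x - x))\<^sup>2)"
proof (cases "x \<in> Fix (string_average E \<omega> U)")
  case True
  then have "U t x = x" if "t \<in> {1..E}" for t
    using assms[OF that] by (auto simp: Fix_def)
  then have "(\<Sum>t=1..E. \<omega> t * (norm (U t x - x))\<^sup>2) = 0"
    by (intro sum.neutral) auto
  with True show ?thesis by (simp add: Fix_def)
next
  case False
  then show ?thesis by (simp add: sigma_max_def Fix_def)
qed

lemma sigma_max_ge_1:
  fixes U :: "nat \<Rightarrow> 'a::real_inner \<Rightarrow> 'a"
  assumes "\<And>t. t \<in> {1..E} \<Longrightarrow> \<omega> t \<ge> 0" and "(\<Sum>t=1..E. \<omega> t) = 1"
  shows "1 \<le> sigma_max E \<omega> U x"
  using norm_string_average_residual_le[of E \<omega> U x, OF assms]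
  by (auto simp: sigma_max_def Fix_def)

text \<open>
  The squared distance to \<open>z\<close> after the step is quadratic in \<open>lam * \<sigma> x\<close>, with linear coefficient
  \<open>- 2 * ((T x - x) \<bullet> (z - x))\<close>, which is at most \<open>- \<sigma> x * (norm (T x - x))\<^sup>2\<close>. The step size
  \<open>\<sigma> x\<close> is just small enough for the linear term to dominate whenever \<open>lam < 1\<close>.
\<close>

lemma extrapolated_step_decrease:
  fixes U :: "nat \<Rightarrow> 'a::real_inner \<Rightarrow> 'a" and E :: nat and \<omega> :: "nat \<Rightarrow> real"
  defines "T \<equiv> string_average E \<omega> U" and "\<sigma> \<equiv> sigma_max E \<omega> U"
  assumes nonneg: "\<And>t. t \<in> {1..E} \<Longrightarrow> \<omega> t \<ge> 0" and sum1: "(\<Sum>t=1..E. \<omega> t) = 1"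
    and Fix: "\<And>t. t \<in> {1..E} \<Longrightarrow> Fix T \<subseteq> Fix (U t)"
    and qne: "\<And>t. t \<in> {1..E} \<Longrightarrow> norm (U t x - z) \<le> norm (x - z)"
    and "0 \<le> lam"
  shows "(norm (gen_relaxation T \<sigma> lam x - z))\<^sup>2
    \<le> (norm (x - z))\<^sup>2 - lam * (1 - lam) * (\<sigma> x * norm (T x - x))\<^sup>2"
proof -
  define v where "v = T x - x"
  have "\<sigma> x * (norm v)\<^sup>2 \<le> 2 * (v \<bullet> (z - x))"
    unfolding v_def T_def \<sigma>_def
    using sigma_max_residual[of E \<omega> U x] Fix string_average_residual_inner[of E \<omega> U x z]
      nonneg sum1 qne
    by (simp add: T_def)
  moreover have "1 \<le> \<sigma> x"
    unfolding \<sigma>_def using nonneg sum1 by (rule sigma_max_ge_1)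
  ultimately have "lam * \<sigma> x * (\<sigma> x * (norm v)\<^sup>2) \<le> lam * \<sigma> x * (2 * (v \<bullet> (z - x)))"
    using \<open>0 \<le> lam\<close> by (intro mult_left_mono) auto
  moreover have "(norm (gen_relaxation T \<sigma> lam x - z))\<^sup>2
      = (norm (x - z))\<^sup>2 - lam * \<sigma> x * (2 * (v \<bullet> (z - x))) + (lam * \<sigma> x)\<^sup>2 * (norm v)\<^sup>2"
    unfolding gen_relaxation_def v_def[symmetric] power2_norm_eq_inner
    by (simp add: power2_eq_square inner_add inner_diff inner_commute
        algebra_simps)
  ultimately show ?thesis
    unfolding v_def[symmetric] by (simp add: power2_eq_square algebra_simps)
qed

text \<open>
  A decreasing sequence bounded below converges, so its successive decreases tend to \<open>0\<close>.
\<close>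

lemma sufficient_decrease:
  fixes a b :: "nat \<Rightarrow> real"
  assumes "\<And>k. 0 \<le> a k" "0 < c" and step: "\<And>k. a (Suc k) \<le> a k - c * (b k)\<^sup>2"
  shows "convergent a" and "b \<longlonglongrightarrow> 0"
proof -
  have "a (Suc k) \<le> a k" for k
  proof -
    have "0 \<le> c * (b k)\<^sup>2" using assms(2) by simp
    then show ?thesis using step[of k] by linarith
  qed
  then have "decseq a" by (simp add: decseq_Suc_iff)
  then obtain L where L: "a \<longlonglongrightarrow> L"
    using decseq_convergent[of a 0] assms(1) by blast
  then show "convergent a" by (auto simp: convergent_def)
  have "(\<lambda>k. (a k - a (Suc k)) / c) \<longlonglongrightarrow> (L - L) / c"
    using L LIMSEQ_Suc assms(2) by (intro tendsto_intros) auto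
  moreover have "(b k)\<^sup>2 \<le> (a k - a (Suc k)) / c" for k
    using step[of k] assms(2) by (simp add: field_simps)
  ultimately have "(\<lambda>k. (b k)\<^sup>2) \<longlonglongrightarrow> 0"
    by (intro tendsto_sandwich[of "\<lambda>_. 0" "\<lambda>k. (b k)\<^sup>2" _ "\<lambda>k. (a k - a (Suc k)) / c"]) auto
  then have "(\<lambda>k. sqrt ((b k)\<^sup>2)) \<longlonglongrightarrow> 0"
    using tendsto_real_sqrt by fastforce
  then show "b \<longlonglongrightarrow> 0"
    by (simp add: tendsto_rabs_zero_iff)
qed

theorem theorem3p4:
  fixes Ts :: "nat \<Rightarrow> 'a::{real_inner, complete_space} \<Rightarrow> 'a"
    and m E :: nat
    and I :: "nat \<Rightarrow> nat list"
    and \<omega> :: "nat \<Rightarrow> real"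
    and U :: "nat \<Rightarrow> 'a \<Rightarrow> 'a"
    and T :: "'a \<Rightarrow> 'a"
    and \<epsilon> :: real
    and lam :: "nat \<Rightarrow> real"
    and x :: "nat \<Rightarrow> 'a"
  assumes "\<And>i. i \<in> {1..m} \<Longrightarrow> sQNE (Ts i)"
    and "(\<Inter>i\<in>{1..m}. Fix (Ts i)) \<noteq> {}"
    and "\<And>t. t \<in> {1..E} \<Longrightarrow> is_string m (I t)"
    and "(\<Union>t\<in>{1..E}. set (I t)) = {1..m}"
    and "\<And>t. t \<in> {1..E} \<Longrightarrow> \<omega> t > 0"
    and "(\<Sum>t=1..E. \<omega> t) = 1"
    and "U = (\<lambda>t. string_op Ts (I t))"
    and "T = string_average E \<omega> U"
    and "Fix T \<noteq> {}"
    and "0 < \<epsilon>" and "\<epsilon> < 1 / 2"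
    and "\<And>k. lam k \<in> {\<epsilon>..1 - \<epsilon>}"
    and "\<And>k. x (Suc k) = gen_relaxation T (sigma_max E \<omega> U) (lam k) (x k)"
    and "demi_closed_at_0 (\<lambda>y. T y - y) \<or>
         (\<forall>t\<in>{1..E}. demi_closed_at_0 (\<lambda>y. U t y - y))"
  shows "\<exists>z\<in>Fix T. weakly_converges x z"
proof -
  note pos = assms(5) and sum1 = assms(6)
  define \<sigma> where "\<sigma> = sigma_max E \<omega> U"
  have nonneg: "\<And>t. t \<in> {1..E} \<Longrightarrow> \<omega> t \<ge> 0" using pos less_imp_le by blast
  have FixT: "Fix T = (\<Inter>i\<in>{1..m}. Fix (Ts i))"
    unfolding assms(7,8)
    using Fix_string_average[where I = I and \<omega> = \<omega>, OF assms(1,2,4) pos sum1] by simp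
  have in_range: "i \<in> {1..m}" if "t \<in> {1..E}" "i \<in> set (I t)" for i t
    using assms(4) that by blast
  have FixU: "Fix T \<subseteq> Fix (U t)" if "t \<in> {1..E}" for t
  proof
    fix z assume "z \<in> Fix T"
    then show "z \<in> Fix (U t)"
      unfolding assms(7) using in_range[OF that] FixT by (intro string_op_fixed) blast
  qed
  have qne: "norm (U t y - z) \<le> norm (y - z)" if "t \<in> {1..E}" "z \<in> Fix T" for t y z
    unfolding assms(7) using in_range[OF that(1)] that(2) FixT assms(1)
    by (intro string_op_quasi_nonexpansive(1)) blast+
  define b where "b k = \<sigma> (x k) * norm (T (x k) - x k)" for k
  have step: "(norm (x (Suc k) - z))\<^sup>2 \<le> (norm (x k - z))\<^sup>2 - \<epsilon>\<^sup>2 * (b k)\<^sup>2"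
    if z: "z \<in> Fix T" for k z
  proof -
    have lam: "\<epsilon> \<le> lam k" "\<epsilon> \<le> 1 - lam k" using assms(12)[of k] by auto
    have "(norm (x (Suc k) - z))\<^sup>2 \<le> (norm (x k - z))\<^sup>2 - lam k * (1 - lam k) * (b k)\<^sup>2"
      unfolding assms(13)[of k] b_def \<sigma>_def assms(8)
      using lam assms(10) qne[OF _ z] FixU nonneg sum1
      by (intro extrapolated_step_decrease) (auto simp: assms(8))
    moreover have "\<epsilon>\<^sup>2 \<le> lam k * (1 - lam k)"
      unfolding power2_eq_square using lam assms(10) by (intro mult_mono) auto
    then have "\<epsilon>\<^sup>2 * (b k)\<^sup>2 \<le> lam k * (1 - lam k) * (b k)\<^sup>2"
      by (intro mult_right_mono) auto
    ultimately show ?thesis by linarith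
  qed
  have dist_conv: "convergent (\<lambda>k. norm (x k - z))" if z: "z \<in> Fix T" for z
  proof -
    have "convergent (\<lambda>k. (norm (x k - z))\<^sup>2)"
      using sufficient_decrease(1)[of "\<lambda>k. (norm (x k - z))\<^sup>2" "\<epsilon>\<^sup>2" b]
        step[OF z] assms(10) by simp
    then obtain L where "(\<lambda>k. (norm (x k - z))\<^sup>2) \<longlonglongrightarrow> L"
      by (auto simp: convergent_def)
    then have "(\<lambda>k. sqrt ((norm (x k - z))\<^sup>2)) \<longlonglongrightarrow> sqrt L"
      by (rule tendsto_real_sqrt)
    then show ?thesis by (auto simp: convergent_def)
  qed
  obtain z0 where z0: "z0 \<in> Fix T" using assms(9) by blast
  have b0: "b \<longlonglongrightarrow> 0"
    using sufficient_decrease(2)[of "\<lambda>k. (norm (x k - z0))\<^sup>2" "\<epsilon>\<^sup>2" b]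
      step[OF z0] assms(10) by simp
  have T_res_le: "norm (T (x k) - x k) \<le> b k" for k
    using mult_right_mono[OF sigma_max_ge_1[OF nonneg sum1, of U "x k"], of "norm (T (x k) - x k)"]
    by (simp add: b_def \<sigma>_def)
  have "(\<lambda>k. norm (T (x k) - x k)) \<longlonglongrightarrow> 0"
    using b0 T_res_le by (intro tendsto_sandwich[OF _ _ tendsto_const b0]) auto
  then have T_res: "(\<lambda>k. T (x k) - x k) \<longlonglongrightarrow> 0"
    by (rule tendsto_norm_zero_cancel)
  \<comment> \<open>each string residual is controlled through the weighted sum, which is \<open>b k\<close> times a null sequence\<close>
  have U_res: "(\<lambda>k. U t (x k) - x k) \<longlonglongrightarrow> 0" if t: "t \<in> {1..E}" for t
  proof -
    have le: "(norm (U t (x k) - x k))\<^sup>2 \<le> (b k * norm (T (x k) - x k)) / \<omega> t" for k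
    proof -
      have "\<omega> t * (norm (U t (x k) - x k))\<^sup>2 \<le> (\<Sum>t=1..E. \<omega> t * (norm (U t (x k) - x k))\<^sup>2)"
        using t nonneg by (intro member_le_sum) auto
      also have "\<dots> = b k * norm (T (x k) - x k)"
        using sigma_max_residual[of E \<omega> U "x k"] FixU
        by (simp add: assms(8) b_def \<sigma>_def power2_eq_square mult.assoc)
      finally show ?thesis
        using pos[OF t] by (simp add: field_simps)
    qed
    have "(\<lambda>k. (b k * norm (T (x k) - x k)) / \<omega> t) \<longlonglongrightarrow> (0 * norm (0::'a)) / \<omega> t"
      using pos[OF t] by (intro tendsto_intros b0 T_res) auto
    then have lim: "(\<lambda>k. (b k * norm (T (x k) - x k)) / \<omega> t) \<longlonglongrightarrow> 0" by simp
    have "(\<lambda>k. (norm (U t (x k) - x k))\<^sup>2) \<longlonglongrightarrow> 0"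
      using le by (intro tendsto_sandwich[OF _ _ tendsto_const lim]) auto
    from tendsto_real_sqrt[OF this] show ?thesis
      by (subst tendsto_norm_zero_iff[symmetric]) simp
  qed
  show ?thesis
  proof (rule opial[OF assms(9) dist_conv])
    fix r l assume r: "strict_mono r" "weakly_converges (x \<circ> r) l"
    from assms(14) show "l \<in> Fix T"
    proof
      assume "demi_closed_at_0 (\<lambda>y. T y - y)"
      from demi_closed_zero_of_subsequence[OF this T_res r] show ?thesis
        by (simp add: Fix_def)
    next
      assume dc: "\<forall>t\<in>{1..E}. demi_closed_at_0 (\<lambda>y. U t y - y)"
      have "U t l - l = 0" if "t \<in> {1..E}" for t
        using demi_closed_zero_of_subsequence[OF dc[rule_format, OF that] U_res[OF that] r] .
      then have "T l - l = 0"
        unfolding assms(8) string_average_residual[OF sum1] by (intro sum.neutral) simp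
      then show ?thesis by (simp add: Fix_def)
    qed
  qed
qed

end
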